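(* Let $\{\mathcal{C}_n\}$ be a sequence of binary linear codes with blocklengths $N_n\to\infty$ and rates $r_n\to r$ for some $r\in(0,1)$, such that the permutation group of each $\mathcal{C}_n$ is doubly transitive. Then $\{\mathcal{C}_n\}$ is capacity achieving on the BEC under bit-MAP decoding.
   Context: Binary linear codes $\mathcal{C}\subseteq\{0,1\}^N$ are assumed proper and of minimum distance at least $2$; rate $=K/N$. The permutation group of $\mathcal{C}$ is the set of permutations $\pi$ of the coordinates $[N]$ mapping every codeword to a codeword; it is doubly transitive if for all distinct $i,j,k\in[N]$ it contains $\pi$ with $\pi(i)=i$, $\pi(j)=k$. A uniformly random codeword $\underline{X}$ is sent over $\mathrm{BEC}(p)$ (each bit erased independently with probability $p$) giving $\underline{Y}$; $P_b(p)=\frac1N\sum_{i}\Pr(X_i\text{ is not uniquely determined by }\underline{Y})$. A sequence of codes with rates $r_n\to r\in(0,1)$ is capacity achieving on the BEC under bit-MAP decoding if $\lim_n P_b^{(n)}(p)=0$ for every $p\in[0,1-r)$. *)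

theory Defs
  imports Complex_Main "HOL-Combinatorics.Permutations"
begin

definition binary_linear_code :: "nat \<Rightarrow> (nat \<Rightarrow> bool) set \<Rightarrow> bool" where
  "binary_linear_code N C \<longleftrightarrow>
     C \<subseteq> {x. \<forall>j. N \<le> j \<longrightarrow> \<not> x j} \<and>
     (\<lambda>_. False) \<in> C \<and>
     (\<forall>x\<in>C. \<forall>y\<in>C. (\<lambda>j. x j \<noteq> y j) \<in> C)"

definition proper_code :: "nat \<Rightarrow> (nat \<Rightarrow> bool) set \<Rightarrow> bool" where
  "proper_code N C \<longleftrightarrow> (\<forall>i<N. \<exists>c\<in>C. c i)"

definition min_dist_ge2 :: "nat \<Rightarrow> (nat \<Rightarrow> bool) set \<Rightarrow> bool" where
  "min_dist_ge2 N C \<longleftrightarrow>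
     (\<forall>x\<in>C. \<forall>y\<in>C. x \<noteq> y \<longrightarrow> 2 \<le> card {j. j < N \<and> x j \<noteq> y j})"

definition code_rate :: "nat \<Rightarrow> (nat \<Rightarrow> bool) set \<Rightarrow> real" where
  "code_rate N C = log 2 (real (card C)) / real N"

definition perm_group :: "nat \<Rightarrow> (nat \<Rightarrow> bool) set \<Rightarrow> (nat \<Rightarrow> nat) set" where
  "perm_group N C = {\<pi>. \<pi> permutes {..<N} \<and> (\<forall>c\<in>C. (c \<circ> \<pi>) \<in> C)}"

definition doubly_transitive :: "nat \<Rightarrow> (nat \<Rightarrow> nat) set \<Rightarrow> bool" where
  "doubly_transitive N G \<longleftrightarrow>
     (\<forall>i<N. \<forall>j<N. \<forall>k<N. i \<noteq> j \<and> j \<noteq> k \<and> i \<noteq> k \<longrightarrow>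
        (\<exists>\<pi>\<in>G. \<pi> i = i \<and> \<pi> j = k))"

text \<open>Bit erasure probability under bit-MAP decoding on BEC(p): average over
  positions i, erasure sets E (erased coordinates, probability p^|E| (1-p)^(N-|E|)),
  and uniformly random transmitted codeword x, of the indicator that x i is not
  uniquely determined by the unerased coordinates.\<close>
definition bit_map_Pb :: "nat \<Rightarrow> (nat \<Rightarrow> bool) set \<Rightarrow> real \<Rightarrow> real" where
  "bit_map_Pb N C p =
     (1 / real N) * (\<Sum>i<N. \<Sum>E\<in>Pow {..<N}.
        p ^ card E * (1 - p) ^ (N - card E) *
        ((1 / real (card C)) * (\<Sum>x\<in>C.
           (if \<exists>c\<in>C. (\<forall>j<N. j \<notin> E \<longrightarrow> c j = x j) \<and> c i \<noteq> x i then 1 else 0))))"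

end

theory Submission
  imports Defs "HOL-Analysis.Convex"
begin

text \<open>
  Let \<open>h\<^sub>i(p)\<close> be the probability that bit \<open>i\<close> cannot be recovered from the unerased bits among
  the other positions. Double transitivity makes all \<open>h\<^sub>i\<close> equal to one function \<open>h\<close>, and makes the
  influences of all positions \<open>j \<noteq> i\<close> on this event equal. By Russo's formula, \<open>h'\<close> is the sum of
  the influences. A logarithmic Sobolev inequality, applied to the martingale differences of a
  function \<open>f\<close> as in the argument of Falik and Samorodnitsky, gives
  \<open>l Var f \<le> 2 \<Sum>\<^sub>j E (D\<^sub>j f)\<^sup>2 + e\<^sup>l \<Sum>\<^sub>j (E \<bar>D\<^sub>j f\<bar>)\<^sup>2\<close> for every \<open>l\<close>.
  Here this reads \<open>l h (1 - h) \<le> 2 h' + e\<^sup>l h'\<^sup>2 / (N - 1)\<close>, so \<open>h'\<close> is large, for large \<open>N\<close>,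
  wherever \<open>h\<close> is bounded away from \<open>0\<close> and \<open>1\<close>; that is, \<open>h\<close> has a sharp threshold.
  Since \<open>h\<close> is increasing and its integral is the rate, \<open>(1 - p) h(p)\<close> is at most the rate;
  hence \<open>h\<close> cannot be close to \<open>1\<close> before \<open>1 - r\<close>, and must tend to \<open>0\<close> there.
\<close>

section \<open>Product measure on subsets, discrete derivatives and Russo's formula\<close>

text \<open>Expectation over a random subset of \<open>S\<close> containing each element independently with
  probability \<open>p\<close>.\<close>

definition bexp :: "real \<Rightarrow> 'a set \<Rightarrow> ('a set \<Rightarrow> real) \<Rightarrow> real" where
  "bexp p S f = (\<Sum>A\<in>Pow S. p ^ card A * (1 - p) ^ (card S - card A) * f A)"

text \<open>The value ignores whether \<open>i\<close> lies in \<open>A\<close>, so it can be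
  averaged over all subsets of \<open>S\<close>; for a monotone indicator \<open>f\<close> this
  average is the influence of \<open>i\<close>.\<close>

definition ddiff :: "'a \<Rightarrow> ('a set \<Rightarrow> real) \<Rightarrow> 'a set \<Rightarrow> real" where
  "ddiff i f A = f (insert i A) - f (A - {i})"

lemma bexp_empty [simp]: "bexp p {} f = f {}"
  by (simp add: bexp_def)

text \<open>Conditioning on whether \<open>i\<close> is drawn. The inductions over \<open>S\<close>
  below rest on this identity.\<close>

lemma bexp_insert:
  assumes "finite S" "i \<notin> S"
  shows "bexp p (insert i S) f = p * bexp p S (\<lambda>A. f (insert i A)) + (1 - p) * bexp p S f"
proof -
  let ?w = "\<lambda>A. p ^ card A * (1 - p) ^ (card (insert i S) - card A) * f A"
  have inj: "inj_on (insert i) (Pow S)"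
    using assms(2) by (auto simp: inj_on_def)
  have "bexp p (insert i S) f = sum ?w (Pow S) + sum ?w (insert i ` Pow S)"
    unfolding bexp_def Pow_insert using assms by (intro sum.union_disjoint) auto
  moreover have "sum ?w (Pow S) = (1 - p) * bexp p S f"
    unfolding bexp_def sum_distrib_left
  proof (rule sum.cong)
    fix A assume "A \<in> Pow S"
    then have "card A \<le> card S" using assms by (auto intro: card_mono)
    then show "?w A = (1 - p) * (p ^ card A * (1 - p) ^ (card S - card A) * f A)"
      using assms by (simp add: Suc_diff_le)
  qed simp
  moreover have "sum ?w (insert i ` Pow S) = p * bexp p S (\<lambda>A. f (insert i A))"
    unfolding bexp_def sum_distrib_left sum.reindex[OF inj]
  proof (rule sum.cong)
    fix A assume "A \<in> Pow S"
    then have "finite A" "i \<notin> A" using assms by (auto intro: finite_subset)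
    then show "(?w \<circ> insert i) A =
        p * (p ^ card A * (1 - p) ^ (card S - card A) * f (insert i A))"
      using assms by simp
  qed simp
  ultimately show ?thesis by simp
qed

lemma bexp_cong: "(\<And>A. A \<subseteq> S \<Longrightarrow> f A = g A) \<Longrightarrow> bexp p S f = bexp p S g"
  by (auto simp: bexp_def intro!: sum.cong)

lemma bexp_add: "bexp p S (\<lambda>A. f A + g A) = bexp p S f + bexp p S g"
  by (simp add: bexp_def sum.distrib distrib_left)

lemma bexp_diff: "bexp p S (\<lambda>A. f A - g A) = bexp p S f - bexp p S g"
  by (simp add: bexp_def sum_subtractf right_diff_distrib)

lemma bexp_cmult: "bexp p S (\<lambda>A. c * f A) = c * bexp p S f"
  by (simp add: bexp_def sum_distrib_left mult_ac)

lemma bexp_const: "finite S \<Longrightarrow> bexp p S (\<lambda>A. c) = c"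
  by (induction S rule: finite_induct) (auto simp: bexp_insert algebra_simps)

lemma bexp_at_1: "finite S \<Longrightarrow> bexp 1 S f = f S"
  by (induction S arbitrary: f rule: finite_induct) (auto simp: bexp_insert)

lemma bexp_mono:
  assumes "0 \<le> p" "p \<le> 1" "\<And>A. A \<subseteq> S \<Longrightarrow> f A \<le> g A"
  shows "bexp p S f \<le> bexp p S g"
  unfolding bexp_def using assms by (intro sum_mono mult_left_mono) auto

lemma bexp_nonneg:
  assumes "0 \<le> p" "p \<le> 1" "\<And>A. A \<subseteq> S \<Longrightarrow> 0 \<le> f A"
  shows "0 \<le> bexp p S f"
  unfolding bexp_def using assms by (intro sum_nonneg mult_nonneg_nonneg) auto

lemma bexp_permutes:
  assumes "\<pi> permutes S" "finite S"
  shows "bexp p S (\<lambda>A. f (\<pi> ` A)) = bexp p S f"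
proof -
  have inj: "inj \<pi>" using assms(1) by (rule permutes_inj)
  have im: "(`) \<pi> ` Pow S = Pow S"
    using assms(1) by (simp add: image_Pow_surj permutes_image)
  have "bexp p S f = (\<Sum>A\<in>(`) \<pi> ` Pow S. p ^ card A * (1 - p) ^ (card S - card A) * f A)"
    by (simp add: bexp_def im)
  also have "\<dots> = bexp p S (\<lambda>A. f (\<pi> ` A))"
  proof -
    have "inj_on ((`) \<pi>) (Pow S)" using inj by (auto simp: inj_on_def inj_image_eq_iff)
    moreover have "card (\<pi> ` A) = card A" for A
      using inj by (meson card_image inj_on_subset subset_UNIV)
    ultimately show ?thesis by (simp add: bexp_def sum.reindex)
  qed
  finally show ?thesis by simp
qed

lemma bexp_Cauchy_Schwarz:
  assumes "0 \<le> p" "p \<le> 1"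
  shows "bexp p S (\<lambda>A. f A * g A) \<le> sqrt (bexp p S (\<lambda>A. (f A)\<^sup>2)) * sqrt (bexp p S (\<lambda>A. (g A)\<^sup>2))"
proof -
  \<comment> \<open>Giving each factor the square root of the weight reduces the claim to the
    inequality for plain sums.\<close>
  define w where "w A = sqrt (p ^ card A * (1 - p) ^ (card S - card A))" for A :: "'a set"
  have w2: "w A * w A = p ^ card A * (1 - p) ^ (card S - card A)" for A
    using assms by (simp add: w_def)
  have b: "bexp p S h = (\<Sum>A\<in>Pow S. w A * w A * h A)" for h
    by (simp add: bexp_def w2)
  have "(\<Sum>A\<in>Pow S. (w A * f A) * (w A * g A))\<^sup>2
      \<le> (\<Sum>A\<in>Pow S. (w A * f A)\<^sup>2) * (\<Sum>A\<in>Pow S. (w A * g A)\<^sup>2)"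
    by (rule Cauchy_Schwarz_ineq_sum)
  then have "(bexp p S (\<lambda>A. f A * g A))\<^sup>2 \<le> bexp p S (\<lambda>A. (f A)\<^sup>2) * bexp p S (\<lambda>A. (g A)\<^sup>2)"
    by (simp add: b power2_eq_square mult_ac)
  then show ?thesis
    by (metis real_le_rsqrt real_sqrt_mult)
qed

lemma ddiff_insert: "i \<noteq> j \<Longrightarrow> ddiff j f (insert i A) = ddiff j (\<lambda>A. f (insert i A)) A"
  by (simp add: ddiff_def insert_commute insert_Diff_if)

lemma ddiff_image: "inj \<pi> \<Longrightarrow> ddiff (\<pi> j) f (\<pi> ` A) = ddiff j (\<lambda>A. f (\<pi> ` A)) A"
  by (simp add: ddiff_def image_set_diff)

lemma ddiff_nonneg: "mono f \<Longrightarrow> 0 \<le> ddiff i f A"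
  by (simp add: ddiff_def monoD subset_insertI2)

text \<open>The parameter \<open>\<phi>\<close> lets this identity and the next cover plain, squared
  and absolute derivatives at once.\<close>

lemma bexp_ddiff_new:
  assumes "finite S" "i \<notin> S"
  shows "bexp p (insert i S) (\<lambda>A. \<phi> (ddiff i f A)) = bexp p S (\<lambda>A. \<phi> (f (insert i A) - f A))"
proof -
  have "bexp p S (\<lambda>A. \<phi> (ddiff i f (insert i A))) = bexp p S (\<lambda>A. \<phi> (f (insert i A) - f A))"
    "bexp p S (\<lambda>A. \<phi> (ddiff i f A)) = bexp p S (\<lambda>A. \<phi> (f (insert i A) - f A))"
    using assms
    by (auto simp: ddiff_def subset_eq intro!: bexp_cong arg_cong[where f = \<phi>] arg_cong[where f = f])
  then show ?thesis using assms by (simp add: bexp_insert algebra_simps)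
qed

lemma bexp_ddiff_old:
  assumes "finite S" "i \<notin> S" "j \<in> S"
  shows "bexp p (insert i S) (\<lambda>A. \<phi> (ddiff j f A)) =
    p * bexp p S (\<lambda>A. \<phi> (ddiff j (\<lambda>A. f (insert i A)) A)) + (1 - p) * bexp p S (\<lambda>A. \<phi> (ddiff j f A))"
proof -
  have "i \<noteq> j" using assms by auto
  then show ?thesis using assms by (simp add: bexp_insert ddiff_insert)
qed

text \<open>Russo's formula, by differentiating \<open>bexp_insert\<close>: the factors
  \<open>p\<close> and \<open>1 - p\<close> yield the influence of the new element, the induction
  hypothesis yields the others.\<close>

lemma bexp_deriv:
  assumes "finite S"
  shows "((\<lambda>p. bexp p S f) has_real_derivative (\<Sum>i\<in>S. bexp p S (ddiff i f))) (at p)"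
  using assms
proof (induction S arbitrary: f rule: finite_induct)
  case (insert i S)
  let ?f1 = "\<lambda>A. f (insert i A)"
  have eq: "(\<Sum>j\<in>insert i S. bexp p (insert i S) (ddiff j f)) =
      (bexp p S ?f1 - bexp p S f) +
      (p * (\<Sum>j\<in>S. bexp p S (ddiff j ?f1)) + (1 - p) * (\<Sum>j\<in>S. bexp p S (ddiff j f)))"
  proof -
    have "bexp p (insert i S) (ddiff i f) = bexp p S (\<lambda>A. ?f1 A - f A)"
      using bexp_ddiff_new[OF insert.hyps, of p "\<lambda>x. x"] by simp
    moreover have "bexp p (insert i S) (ddiff j f) =
        p * bexp p S (ddiff j ?f1) + (1 - p) * bexp p S (ddiff j f)" if "j \<in> S" for j
      using bexp_ddiff_old[OF insert.hyps that, of p "\<lambda>x. x"] by simp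
    ultimately show ?thesis
      using insert.hyps by (simp add: bexp_diff sum.distrib sum_distrib_left)
  qed
  show ?case
    unfolding eq unfolding bexp_insert[OF insert.hyps]
    by (rule derivative_eq_intros insert.IH refl)+ (simp add: algebra_simps)
qed simp

section \<open>Entropy and the logarithmic Sobolev inequality\<close>

text \<open>Entropy is at most variance over mean, and \<open>a - b\<close> factors as
  \<open>(sqrt a - sqrt b) * (sqrt a + sqrt b)\<close>; the second factor, squared and weighted by
  \<open>p * (1 - p)\<close>, is at most twice the mean.\<close>

lemma two_point_entropy:
  fixes a b p :: real
  assumes "0 \<le> p" "p \<le> 1" "0 \<le> a" "0 \<le> b"
  shows "p * (a * ln a) + (1 - p) * (b * ln b) - (p * a + (1 - p) * b) * ln (p * a + (1 - p) * b)
    \<le> 2 * (sqrt a - sqrt b)\<^sup>2"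
proof -
  define m where "m = p * a + (1 - p) * b"
  have m0: "0 \<le> m" using assms by (simp add: m_def)
  show ?thesis
  proof (cases "m = 0")
    case True
    \<comment> \<open>A zero mean forces only the weighted products to vanish, not \<open>a\<close>
      and \<open>b\<close> themselves.\<close>
    then have "p * a = 0" "(1 - p) * b = 0"
      using assms unfolding m_def by (smt (verit) mult_nonneg_nonneg)+
    then have "p * (a * ln a) = 0" "(1 - p) * (b * ln b) = 0" by auto
    with True show ?thesis unfolding m_def by (simp only: mult_zero_left) simp
  next
    case False
    with m0 have m: "0 < m" by simp
    \<comment> \<open>Tangent of \<open>ln\<close> at the mean \<open>m\<close>;
      \<open>x = 0\<close> is harmless since the factor \<open>x\<close> annihilates the
      logarithm.\<close>
    have ln_le: "x * ln x \<le> x * ln m + x * (x / m - 1)" if "0 \<le> x" for x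
    proof (cases "x = 0")
      case False
      with that have x: "0 < x" by simp
      have "ln (x / m) \<le> x / m - 1" using x m by (intro ln_le_minus_one) simp
      then have "x * (ln x - ln m) \<le> x * (x / m - 1)"
        using x m by (simp add: ln_div)
      then show ?thesis by (simp add: algebra_simps)
    qed simp
    have "p * (a * ln a) + (1 - p) * (b * ln b) - m * ln m \<le>
        p * (a * ln m + a * (a / m - 1)) + (1 - p) * (b * ln m + b * (b / m - 1)) - m * ln m"
      using assms by (intro diff_right_mono add_mono mult_left_mono ln_le) auto
    also have "\<dots> = (p * a\<^sup>2 + (1 - p) * b\<^sup>2) / m - m"
      using m by (simp add: field_simps power2_eq_square) (simp add: m_def algebra_simps)
    also have "\<dots> = p * (1 - p) * (a - b)\<^sup>2 / m"
    proof -
      have "p * a\<^sup>2 + (1 - p) * b\<^sup>2 - m * m = p * (1 - p) * (a - b)\<^sup>2"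
        by (simp add: m_def power2_eq_square algebra_simps)
      then show ?thesis using m by (simp add: field_simps)
    qed
    also have "\<dots> \<le> 2 * (sqrt a - sqrt b)\<^sup>2"
    proof -
      have ab: "a - b = (sqrt a - sqrt b) * (sqrt a + sqrt b)"
        using assms by (simp add: algebra_simps)
      have s2: "(sqrt a + sqrt b)\<^sup>2 \<le> 2 * (a + b)"
        using assms sum_squares_bound[of "sqrt a" "sqrt b"] by (simp add: power2_sum)
      have "p * (1 - p) * (a + b) \<le> m"
      proof -
        have "p * (1 - p) * a \<le> p * a" "p * (1 - p) * b \<le> (1 - p) * b"
          using assms by (auto intro!: mult_right_mono simp: mult_left_le mult_left_le_one_le)
        then show ?thesis by (simp add: m_def algebra_simps)
      qed
      moreover have "p * (1 - p) * (sqrt a + sqrt b)\<^sup>2 \<le> p * (1 - p) * (2 * (a + b))"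
        using s2 assms by (intro mult_left_mono) auto
      ultimately have "p * (1 - p) * (sqrt a + sqrt b)\<^sup>2 \<le> 2 * m" by linarith
      then have "(sqrt a - sqrt b)\<^sup>2 * (p * (1 - p) * (sqrt a + sqrt b)\<^sup>2)
          \<le> (sqrt a - sqrt b)\<^sup>2 * (2 * m)"
        by (intro mult_left_mono) auto
      then have "p * (1 - p) * (a - b)\<^sup>2 \<le> 2 * (sqrt a - sqrt b)\<^sup>2 * m"
        unfolding ab by (simp add: power_mult_distrib mult_ac)
      then show ?thesis using m by (simp add: pos_divide_le_eq)
    qed
    finally show ?thesis by (simp add: m_def)
  qed
qed

text \<open>Entropy tensorizes: it is the mean of the two conditional entropies given
  \<open>i\<close>, handled by induction, plus the two-point entropy of the conditional second
  moments \<open>a\<close> and \<open>b\<close>.\<close>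

lemma log_Sobolev:
  assumes "finite S" "0 \<le> p" "p \<le> 1"
  shows "bexp p S (\<lambda>A. (g A)\<^sup>2 * ln ((g A)\<^sup>2)) -
      bexp p S (\<lambda>A. (g A)\<^sup>2) * ln (bexp p S (\<lambda>A. (g A)\<^sup>2))
    \<le> 2 * (\<Sum>i\<in>S. bexp p S (\<lambda>A. (ddiff i g A)\<^sup>2))"
  using assms(1)
proof (induction S arbitrary: g rule: finite_induct)
  case (insert i S)
  let ?g1 = "\<lambda>A. g (insert i A)"
  define a where "a = bexp p S (\<lambda>A. (?g1 A)\<^sup>2)"
  define b where "b = bexp p S (\<lambda>A. (g A)\<^sup>2)"
  define D1 where "D1 = (\<Sum>j\<in>S. bexp p S (\<lambda>A. (ddiff j ?g1 A)\<^sup>2))"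
  define D0 where "D0 = (\<Sum>j\<in>S. bexp p S (\<lambda>A. (ddiff j g A)\<^sup>2))"
  define X1 where "X1 = bexp p S (\<lambda>A. (?g1 A)\<^sup>2 * ln ((?g1 A)\<^sup>2))"
  define X0 where "X0 = bexp p S (\<lambda>A. (g A)\<^sup>2 * ln ((g A)\<^sup>2))"
  have ab0: "0 \<le> a" "0 \<le> b" unfolding a_def b_def using assms by (auto intro: bexp_nonneg)
  have Dj: "(\<Sum>j\<in>S. bexp p (insert i S) (\<lambda>A. (ddiff j g A)\<^sup>2)) = p * D1 + (1 - p) * D0"
    using insert.hyps
    by (simp add: D1_def D0_def sum.distrib sum_distrib_left bexp_ddiff_old[where \<phi> = "\<lambda>x. x\<^sup>2"])
  have Di: "bexp p (insert i S) (\<lambda>A. (ddiff i g A)\<^sup>2) = bexp p S (\<lambda>A. (?g1 A - g A)\<^sup>2)"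
    using insert.hyps by (rule bexp_ddiff_new)
  \<comment> \<open>Reverse triangle inequality in L2, from Cauchy-Schwarz.\<close>
  have "(sqrt a - sqrt b)\<^sup>2 \<le> bexp p S (\<lambda>A. (?g1 A - g A)\<^sup>2)"
  proof -
    have "bexp p S (\<lambda>A. (?g1 A - g A)\<^sup>2) = bexp p S (\<lambda>A. (?g1 A)\<^sup>2 + (g A)\<^sup>2 - 2 * (?g1 A * g A))"
      by (simp add: power2_diff mult_ac)
    also have "\<dots> = a + b - 2 * bexp p S (\<lambda>A. ?g1 A * g A)"
      by (simp only: bexp_diff bexp_add bexp_cmult a_def b_def)
    finally show ?thesis
      using bexp_Cauchy_Schwarz[OF assms(2,3), of S ?g1 g] ab0
      by (simp add: power2_diff flip: a_def b_def)
  qed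
  moreover have "p * (X1 - a * ln a) \<le> p * (2 * D1)" "(1 - p) * (X0 - b * ln b) \<le> (1 - p) * (2 * D0)"
    using insert.IH[of ?g1] insert.IH[of g] assms
    unfolding a_def b_def X1_def X0_def D1_def D0_def by (auto intro!: mult_left_mono)
  moreover note two_point_entropy[OF assms(2,3) ab0]
  ultimately have "p * X1 + (1 - p) * X0 - (p * a + (1 - p) * b) * ln (p * a + (1 - p) * b)
      \<le> 2 * (bexp p S (\<lambda>A. (?g1 A - g A)\<^sup>2) + (p * D1 + (1 - p) * D0))"
    by (simp add: right_diff_distrib distrib_left)
  then show ?case
    using insert.hyps by (simp add: Dj Di) (simp add: bexp_insert a_def b_def X1_def X0_def)
qed simp

text \<open>A function whose L1 norm is small against its L2 norm is concentrated on a small set, so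
  its square has large entropy. The free parameter \<open>l\<close> avoids the logarithm of the
  ratio of the norms.\<close>

lemma entropy_lower_bound:
  assumes "finite S" "0 \<le> p" "p \<le> 1"
  shows "l * bexp p S (\<lambda>A. (d A)\<^sup>2) \<le> bexp p S (\<lambda>A. (d A)\<^sup>2 * ln ((d A)\<^sup>2)) -
      bexp p S (\<lambda>A. (d A)\<^sup>2) * ln (bexp p S (\<lambda>A. (d A)\<^sup>2)) + exp l * (bexp p S (\<lambda>A. \<bar>d A\<bar>))\<^sup>2"
proof -
  define m where "m = bexp p S (\<lambda>A. (d A)\<^sup>2)"
  define u where "u = bexp p S (\<lambda>A. \<bar>d A\<bar>)"
  define X where "X = bexp p S (\<lambda>A. (d A)\<^sup>2 * ln ((d A)\<^sup>2))"
  have m0: "0 \<le> m" unfolding m_def using assms by (auto intro: bexp_nonneg)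
  \<comment> \<open>\<open>ln y \<le> y - 1\<close> at \<open>y = s / \<bar>x\<bar>\<close>; the optimal choice is \<open>s\<^sup>2 = e\<^sup>l m\<close>\<close>
  have pt: "(2 * ln s + 2) * x\<^sup>2 - 2 * s * \<bar>x\<bar> \<le> x\<^sup>2 * ln (x\<^sup>2)" if s: "0 < s" for x s :: real
  proof (cases "x = 0")
    case False
    have "ln (s / \<bar>x\<bar>) \<le> s / \<bar>x\<bar> - 1" using False s by (intro ln_le_minus_one) simp
    then have "ln s - ln \<bar>x\<bar> \<le> s / \<bar>x\<bar> - 1" using False s by (simp add: ln_div)
    then have "x\<^sup>2 * (2 * ln s - 2 * ln \<bar>x\<bar>) \<le> x\<^sup>2 * (2 * (s / \<bar>x\<bar>) - 2)"
      by (intro mult_left_mono) auto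
    moreover have "x\<^sup>2 * (s / \<bar>x\<bar>) = s * \<bar>x\<bar>"
      using False by (simp add: field_simps power2_eq_square)
    moreover have "ln (x\<^sup>2) = 2 * ln \<bar>x\<bar>"
      using False ln_realpow[of "\<bar>x\<bar>" 2] by simp
    ultimately show ?thesis by (simp add: algebra_simps del: times_divide_eq_right)
  qed simp
  have ptX: "(2 * ln s + 2) * m - 2 * s * u \<le> X" if "0 < s" for s
  proof -
    have "bexp p S (\<lambda>A. (2 * ln s + 2) * (d A)\<^sup>2 - 2 * s * \<bar>d A\<bar>) \<le> X"
      unfolding X_def using assms pt[OF that] by (intro bexp_mono) auto
    then show ?thesis by (simp add: bexp_diff bexp_cmult m_def u_def)
  qed
  show ?thesis
  proof (cases "m = 0")
    case True
    \<comment> \<open>With \<open>m = 0\<close> this gives \<open>u \<le> 0\<close>, after which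
      \<open>s = 1\<close> in \<open>ptX\<close> yields \<open>0 \<le> X\<close>.\<close>
    have "u \<le> sqrt m * sqrt (bexp p S (\<lambda>A. 1\<^sup>2))"
      unfolding u_def m_def
      using bexp_Cauchy_Schwarz[OF assms(2,3), of S "\<lambda>A. \<bar>d A\<bar>" "\<lambda>_. 1"] by simp
    then have "0 \<le> X" using ptX[of 1] True by simp
    then show ?thesis using True by (simp flip: m_def u_def X_def)
  next
    case False
    with m0 have m: "0 < m" by simp
    define s where "s = exp (l / 2) * sqrt m"
    have "0 < s" "2 * ln s = ln m + l" using m by (auto simp: s_def ln_mult ln_sqrt)
    then have "(ln m + l + 2) * m - 2 * s * u \<le> X" using ptX[of s] by simp
    moreover have "2 * s * u \<le> m + exp l * u\<^sup>2"
    proof -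
      have "2 * sqrt m * (exp (l / 2) * u) \<le> (sqrt m)\<^sup>2 + (exp (l / 2) * u)\<^sup>2"
        by (rule sum_squares_bound)
      moreover have "(exp (l / 2))\<^sup>2 = exp l" by (simp flip: exp_double)
      ultimately show ?thesis using m by (simp add: s_def power_mult_distrib mult_ac)
    qed
    ultimately show ?thesis using m by (simp add: algebra_simps flip: m_def u_def X_def)
  qed
qed

section \<open>Variance bounded by influences\<close>

lemma variance_influence_bound:
  assumes "finite S" "0 \<le> p" "p \<le> 1"
  shows "l * (bexp p S (\<lambda>A. (f A)\<^sup>2) - (bexp p S f)\<^sup>2) \<le>
    2 * (\<Sum>i\<in>S. bexp p S (\<lambda>A. (ddiff i f A)\<^sup>2)) +
    exp l * (\<Sum>i\<in>S. (bexp p S (\<lambda>A. \<bar>ddiff i f A\<bar>))\<^sup>2)"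
  using assms(1)
proof (induction S arbitrary: f rule: finite_induct)
  case (insert i S)
  \<comment> \<open>\<open>f = g + d\<close> with \<open>g\<close> the average of \<open>f\<close> over coordinate \<open>i\<close>; both sides split orthogonally,
    the induction hypothesis handles \<open>g\<close> and the logarithmic Sobolev inequality handles \<open>d\<close>.\<close>
  note ins = bexp_insert[OF insert.hyps]
  let ?S = "insert i S"
  define f1 where "f1 A = f (insert i A)" for A
  define u where "u A = f1 A - f A" for A
  define g where "g A = p * f1 A + (1 - p) * f A" for A
  \<comment> \<open>The two values of \<open>d\<close>, weighted by \<open>p\<close> and
    \<open>1 - p\<close>, have mean zero; this removes the cross terms with \<open>g\<close> in
    \<open>var\<close> and \<open>Dj\<close>.\<close>
  define d where "d A = (if i \<in> A then (1 - p) * u (A - {i}) else - p * u A)" for A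
  have notin: "i \<notin> A" if "A \<subseteq> S" for A using that insert.hyps by auto
  have d1: "d (insert i A) = (1 - p) * u A" and d0: "d A = - p * u A" if "A \<subseteq> S" for A
    using notin[OF that] by (auto simp: d_def)
  have var: "bexp p ?S (\<lambda>A. (f A)\<^sup>2) - (bexp p ?S f)\<^sup>2 =
      bexp p S (\<lambda>A. (g A)\<^sup>2) - (bexp p S g)\<^sup>2 + bexp p ?S (\<lambda>A. (d A)\<^sup>2)"
  proof -
    have 1: "bexp p ?S f = bexp p S g"
      unfolding ins g_def by (simp add: f1_def bexp_add bexp_cmult)
    have "bexp p ?S (\<lambda>A. (f A)\<^sup>2) = bexp p S (\<lambda>A. p * (f1 A)\<^sup>2 + (1 - p) * (f A)\<^sup>2)"
      unfolding ins by (simp add: f1_def bexp_add bexp_cmult)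
    also have "\<dots> = bexp p S (\<lambda>A. (g A)\<^sup>2 + (p * (d (insert i A))\<^sup>2 + (1 - p) * (d A)\<^sup>2))"
      by (rule bexp_cong) (simp add: d1 d0 u_def g_def power2_eq_square algebra_simps)
    also have "\<dots> = bexp p S (\<lambda>A. (g A)\<^sup>2) + bexp p ?S (\<lambda>A. (d A)\<^sup>2)"
      unfolding ins by (simp add: bexp_add bexp_cmult)
    finally show ?thesis using 1 by simp
  qed
  have Di: "bexp p ?S (\<lambda>A. (ddiff i d A)\<^sup>2) = bexp p ?S (\<lambda>A. (ddiff i f A)\<^sup>2)"
  proof (rule bexp_cong)
    fix A assume "A \<subseteq> ?S"
    then have *: "A - {i} \<subseteq> S" by auto
    have "ddiff i d A = (1 - p) * u (A - {i}) + p * u (A - {i})"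
      using d1[OF *] d0[OF *] by (simp add: ddiff_def)
    also have "\<dots> = ddiff i f A" by (simp add: u_def f1_def ddiff_def algebra_simps)
    finally show "(ddiff i d A)\<^sup>2 = (ddiff i f A)\<^sup>2" by simp
  qed
  have Dj: "bexp p ?S (\<lambda>A. (ddiff j f A)\<^sup>2) =
      bexp p S (\<lambda>A. (ddiff j g A)\<^sup>2) + bexp p ?S (\<lambda>A. (ddiff j d A)\<^sup>2)" if "j \<in> S" for j
  proof -
    have ij: "i \<noteq> j" using that insert.hyps by auto
    have "bexp p ?S (\<lambda>A. (ddiff j f A)\<^sup>2) =
        bexp p S (\<lambda>A. p * (ddiff j f1 A)\<^sup>2 + (1 - p) * (ddiff j f A)\<^sup>2)"
      using bexp_ddiff_old[OF insert.hyps that, of p "\<lambda>x. x\<^sup>2" f]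
      by (simp add: f1_def[abs_def] bexp_add bexp_cmult)
    also have "\<dots> = bexp p S (\<lambda>A. (ddiff j g A)\<^sup>2 +
        (p * (ddiff j d (insert i A))\<^sup>2 + (1 - p) * (ddiff j d A)\<^sup>2))"
    proof (rule bexp_cong)
      fix A assume A: "A \<subseteq> S"
      then have A': "insert j A \<subseteq> S" "A - {j} \<subseteq> S" using that by auto
      have 1: "ddiff j d (insert i A) = (1 - p) * (ddiff j f1 A - ddiff j f A)"
        unfolding ddiff_insert[OF ij] using d1[OF A'(1)] d1[OF A'(2)]
        by (simp add: ddiff_def u_def algebra_simps)
      have 2: "ddiff j d A = - p * (ddiff j f1 A - ddiff j f A)"
        using d0[OF A'(1)] d0[OF A'(2)] by (simp add: ddiff_def u_def algebra_simps)
      have 3: "ddiff j g A = p * ddiff j f1 A + (1 - p) * ddiff j f A"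
        by (simp add: ddiff_def g_def algebra_simps)
      show "p * (ddiff j f1 A)\<^sup>2 + (1 - p) * (ddiff j f A)\<^sup>2 = (ddiff j g A)\<^sup>2 +
        (p * (ddiff j d (insert i A))\<^sup>2 + (1 - p) * (ddiff j d A)\<^sup>2)"
        unfolding 1 2 3 by (simp add: power2_eq_square algebra_simps)
    qed
    also have "\<dots> = bexp p S (\<lambda>A. (ddiff j g A)\<^sup>2) + bexp p ?S (\<lambda>A. (ddiff j d A)\<^sup>2)"
      unfolding ins by (simp add: bexp_add bexp_cmult)
    finally show ?thesis .
  qed
  \<comment> \<open>The squared derivatives had to split exactly. For the L1 terms bounds suffice,
    as \<open>d\<close> accounts for \<open>i\<close> alone and \<open>g\<close> for the elements of
    \<open>S\<close>.\<close>
  have Li: "bexp p ?S (\<lambda>A. \<bar>d A\<bar>) \<le> bexp p ?S (\<lambda>A. \<bar>ddiff i f A\<bar>)"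
  proof (rule bexp_mono[OF assms(2,3)])
    fix A
    have u: "u (A - {i}) = ddiff i f A" by (simp add: u_def f1_def ddiff_def)
    show "\<bar>d A\<bar> \<le> \<bar>ddiff i f A\<bar>"
    proof (cases "i \<in> A")
      case True
      then show ?thesis using assms by (simp add: d_def u abs_mult mult_left_le_one_le)
    next
      case False
      then show ?thesis using assms u by (simp add: d_def abs_mult mult_left_le_one_le)
    qed
  qed
  have Lj: "bexp p S (\<lambda>A. \<bar>ddiff j g A\<bar>) \<le> bexp p ?S (\<lambda>A. \<bar>ddiff j f A\<bar>)" if "j \<in> S" for j
  proof -
    have "bexp p S (\<lambda>A. \<bar>ddiff j g A\<bar>) \<le>
        bexp p S (\<lambda>A. p * \<bar>ddiff j f1 A\<bar> + (1 - p) * \<bar>ddiff j f A\<bar>)"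
    proof (rule bexp_mono[OF assms(2,3)])
      fix A
      have "ddiff j g A = p * ddiff j f1 A + (1 - p) * ddiff j f A"
        by (simp add: ddiff_def g_def algebra_simps)
      then show "\<bar>ddiff j g A\<bar> \<le> p * \<bar>ddiff j f1 A\<bar> + (1 - p) * \<bar>ddiff j f A\<bar>"
        using assms abs_triangle_ineq[of "p * ddiff j f1 A" "(1 - p) * ddiff j f A"]
        by (simp add: abs_mult)
    qed
    also have "\<dots> = bexp p ?S (\<lambda>A. \<bar>ddiff j f A\<bar>)"
      using bexp_ddiff_old[OF insert.hyps that, of p abs f]
      by (simp add: f1_def[abs_def] bexp_add bexp_cmult)
    finally show ?thesis .
  qed
  let ?V = "bexp p S (\<lambda>A. (g A)\<^sup>2) - (bexp p S g)\<^sup>2"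
  let ?Ls = "\<Sum>j\<in>S. (bexp p ?S (\<lambda>A. \<bar>ddiff j f A\<bar>))\<^sup>2"
  let ?Lg = "\<Sum>j\<in>S. (bexp p S (\<lambda>A. \<bar>ddiff j g A\<bar>))\<^sup>2"
  let ?Li = "(bexp p ?S (\<lambda>A. \<bar>ddiff i f A\<bar>))\<^sup>2"
  let ?Ld = "(bexp p ?S (\<lambda>A. \<bar>d A\<bar>))\<^sup>2"
  have "l * bexp p ?S (\<lambda>A. (d A)\<^sup>2) \<le>
      2 * (\<Sum>j\<in>?S. bexp p ?S (\<lambda>A. (ddiff j d A)\<^sup>2)) + exp l * ?Ld"
    using entropy_lower_bound[of ?S p l d] log_Sobolev[of ?S p d] insert.hyps assms by simp
  moreover have "l * ?V \<le> 2 * (\<Sum>j\<in>S. bexp p S (\<lambda>A. (ddiff j g A)\<^sup>2)) + exp l * ?Lg"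
    by (rule insert.IH)
  moreover have "exp l * ?Ld \<le> exp l * ?Li"
    using Li assms by (intro mult_left_mono power_mono) (auto intro: bexp_nonneg)
  moreover have "exp l * ?Lg \<le> exp l * ?Ls"
    using Lj assms by (intro mult_left_mono sum_mono power_mono) (auto intro: bexp_nonneg)
  ultimately show ?case
    using insert.hyps unfolding var sum.insert[OF insert.hyps] Di distrib_left
    by (simp only: sum.cong[OF refl Dj] sum.distrib distrib_left)
qed simp

text \<open>The derivatives take only the values 0 and 1, so their first and second moments both
  equal the influence. In each squared influence one factor is replaced by \<open>M\<close>.\<close>

lemma monotone_boolean_influence_bound:
  assumes S: "finite S" and p: "0 \<le> p" "p \<le> 1"
    and bool: "\<And>A. f A = 0 \<or> f A = 1" and mono: "mono f"
    and M: "\<And>j. j \<in> S \<Longrightarrow> bexp p S (ddiff j f) \<le> M"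
  shows "l * (bexp p S f * (1 - bexp p S f)) \<le> (2 + exp l * M) * (\<Sum>j\<in>S. bexp p S (ddiff j f))"
proof -
  note ge0 = ddiff_nonneg[OF mono]
  have d01: "(ddiff j f A)\<^sup>2 = ddiff j f A" for j A
    using bool[of "insert j A"] bool[of "A - {j}"] ge0[of j A] by (auto simp: ddiff_def)
  have f2: "(f A)\<^sup>2 = f A" for A using bool[of A] by auto
  have "(\<Sum>j\<in>S. (bexp p S (ddiff j f))\<^sup>2) \<le> (\<Sum>j\<in>S. M * bexp p S (ddiff j f))"
    unfolding power2_eq_square using M ge0 p
    by (intro sum_mono mult_right_mono) (auto intro: bexp_nonneg)
  then have "exp l * (\<Sum>j\<in>S. (bexp p S (ddiff j f))\<^sup>2) \<le> exp l * (M * (\<Sum>j\<in>S. bexp p S (ddiff j f)))"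
    by (simp flip: sum_distrib_left)
  moreover have "l * (bexp p S f - (bexp p S f)\<^sup>2) \<le> 2 * (\<Sum>j\<in>S. bexp p S (ddiff j f)) +
      exp l * (\<Sum>j\<in>S. (bexp p S (ddiff j f))\<^sup>2)"
    using variance_influence_bound[OF S p, of l f] by (simp add: d01 f2 abs_of_nonneg[OF ge0])
  moreover have "bexp p S f - (bexp p S f)\<^sup>2 = bexp p S f * (1 - bexp p S f)"
    by (simp add: power2_eq_square algebra_simps)
  ultimately show ?thesis by (simp only: distrib_right mult.assoc)
qed

section \<open>EXIT functions of a linear code and their symmetry\<close>

text \<open>The code shortened to \<open>A\<close>, kept at full length. By linearity, the codewords
  agreeing with a codeword \<open>x\<close> off \<open>A\<close> form its coset of this
  subcode.\<close>

definition subcode :: "(nat \<Rightarrow> bool) set \<Rightarrow> nat set \<Rightarrow> (nat \<Rightarrow> bool) set" where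
  "subcode C A = {c\<in>C. \<forall>j. c j \<longrightarrow> j \<in> A}"

text \<open>By linearity, bit \<open>i\<close> is not determined by the bits outside \<open>insert i A\<close> iff some codeword
  supported on \<open>insert i A\<close> is nonzero at \<open>i\<close>.\<close>

definition exit_ind :: "(nat \<Rightarrow> bool) set \<Rightarrow> nat \<Rightarrow> nat set \<Rightarrow> real" where
  "exit_ind C i A = of_bool (\<exists>c\<in>subcode C (insert i A). c i)"

lemma exit_ind_01: "exit_ind C i A = 0 \<or> exit_ind C i A = 1"
  unfolding exit_ind_def of_bool_def by presburger

lemma mono_exit_ind: "mono (exit_ind C i)"
  unfolding mono_def exit_ind_def subcode_def of_bool_def by auto

lemma finite_code:
  assumes "binary_linear_code N C"
  shows "finite C"
proof (rule finite_imageD)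
  have "Collect ` C \<subseteq> Pow {..<N}"
  proof (intro image_subsetI PowI subsetI)
    fix c j assume "c \<in> C" "j \<in> Collect c"
    then show "j \<in> {..<N}" using assms by (fastforce simp: binary_linear_code_def not_le[symmetric])
  qed
  then show "finite (Collect ` C)" by (rule finite_subset) simp
qed (auto simp: inj_on_def dest: Collect_inj)

lemma exit_ind_permute:
  assumes C: "binary_linear_code N C" and \<pi>: "\<pi> \<in> perm_group N C"
  shows "exit_ind C (\<pi> i) (\<pi> ` A) = exit_ind C i A"
proof -
  have bij: "bij \<pi>" using \<pi> by (auto simp: perm_group_def permutes_bij)
  have "inj_on (\<lambda>c. c \<circ> \<pi>) C"
  proof (rule inj_onI, rule ext)
    fix c d :: "nat \<Rightarrow> bool" and x assume "c \<circ> \<pi> = d \<circ> \<pi>"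
    moreover obtain y where "x = \<pi> y" using bij by (rule bij_pointE)
    ultimately show "c x = d x" by (metis comp_apply)
  qed
  then have im: "(\<lambda>c. c \<circ> \<pi>) ` C = C"
    using \<pi> finite_code[OF C] by (intro endo_inj_surj) (auto simp: perm_group_def)
  have supp: "(\<forall>j. (c \<circ> \<pi>) j \<longrightarrow> j \<in> B) \<longleftrightarrow> (\<forall>j. c j \<longrightarrow> j \<in> \<pi> ` B)" for c B
  proof
    assume *: "\<forall>j. (c \<circ> \<pi>) j \<longrightarrow> j \<in> B"
    show "\<forall>j. c j \<longrightarrow> j \<in> \<pi> ` B"
    proof (intro allI impI)
      fix j assume "c j"
      moreover obtain k where "j = \<pi> k" using bij by (rule bij_pointE)
      ultimately show "j \<in> \<pi> ` B" using * by auto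
    qed
  next
    assume "\<forall>j. c j \<longrightarrow> j \<in> \<pi> ` B"
    then show "\<forall>j. (c \<circ> \<pi>) j \<longrightarrow> j \<in> B"
      using inj_image_mem_iff[OF bij_is_inj[OF bij]] by auto
  qed
  have "(\<exists>c\<in>subcode C (insert (\<pi> i) (\<pi> ` A)). c (\<pi> i)) \<longleftrightarrow>
      (\<exists>c\<in>C. (\<forall>j. (c \<circ> \<pi>) j \<longrightarrow> j \<in> insert i A) \<and> (c \<circ> \<pi>) i)"
    unfolding supp unfolding subcode_def image_insert comp_apply Bex_def mem_Collect_eq conj_assoc ..
  also have "\<dots> \<longleftrightarrow> (\<exists>c\<in>(\<lambda>c. c \<circ> \<pi>) ` C. (\<forall>j. c j \<longrightarrow> j \<in> insert i A) \<and> c i)"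
    by (simp only: bex_simps)
  also have "\<dots> \<longleftrightarrow> (\<exists>c\<in>subcode C (insert i A). c i)"
    unfolding im subcode_def Bex_def mem_Collect_eq conj_assoc ..
  finally show ?thesis by (simp add: exit_ind_def)
qed

text \<open>The definition of double transitivity always fixes one point, so moving \<open>i\<close>
  to \<open>k\<close> takes a third coordinate to be fixed; hence \<open>3 \<le> N\<close>.\<close>

lemma exit_eq:
  assumes C: "binary_linear_code N C" and dt: "doubly_transitive N (perm_group N C)"
    and "3 \<le> N" "i < N" "k < N"
  shows "bexp p {..<N} (exit_ind C i) = bexp p {..<N} (exit_ind C k)"
proof (cases "i = k")
  case False
  have "\<not> {..<N} \<subseteq> {i, k}"
    using card_mono[of "{i, k}" "{..<N}"] False assms(3) by auto
  then obtain j where "j < N" "j \<noteq> i" "j \<noteq> k" by auto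
  then obtain \<pi> where \<pi>: "\<pi> \<in> perm_group N C" "\<pi> i = k"
    using dt False assms(4,5) unfolding doubly_transitive_def by metis
  have "\<pi> permutes {..<N}" using \<pi> by (simp add: perm_group_def)
  then show ?thesis
    using bexp_permutes[of \<pi> "{..<N}" p "exit_ind C k"] exit_ind_permute[OF C \<pi>(1), of i] \<pi>(2)
    by simp
qed simp

text \<open>Double transitivity in full: a permutation fixing \<open>i\<close> preserves the event
  at \<open>i\<close> while it carries \<open>j\<close> to \<open>k\<close>.\<close>

lemma exit_influence_eq:
  assumes C: "binary_linear_code N C" and dt: "doubly_transitive N (perm_group N C)"
    and "i < N" "j < N" "k < N" "i \<noteq> j" "i \<noteq> k"
  shows "bexp p {..<N} (ddiff j (exit_ind C i)) = bexp p {..<N} (ddiff k (exit_ind C i))"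
proof (cases "j = k")
  case False
  then obtain \<pi> where \<pi>: "\<pi> \<in> perm_group N C" "\<pi> i = i" "\<pi> j = k"
    using dt assms(3-) unfolding doubly_transitive_def by metis
  have perm: "\<pi> permutes {..<N}" using \<pi> by (simp add: perm_group_def)
  have "ddiff k (exit_ind C i) (\<pi> ` A) = ddiff j (exit_ind C i) A" for A
    using ddiff_image[OF permutes_inj[OF perm], of j "exit_ind C i" A]
      exit_ind_permute[OF C \<pi>(1), of i] \<pi>(2,3) by simp
  then show ?thesis
    using bexp_permutes[OF perm, of p "ddiff k (exit_ind C i)"] by simp
qed simp

text \<open>Position \<open>i\<close> has no influence on its own event, so the total is shared
  equally by the other \<open>N - 1\<close> positions.\<close>

lemma exit_influence_le:
  assumes C: "binary_linear_code N C" and dt: "doubly_transitive N (perm_group N C)"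
    and N: "2 \<le> N" and p: "0 \<le> p" "p \<le> 1" and i: "i < N" and j: "j < N"
  shows "bexp p {..<N} (ddiff j (exit_ind C i)) \<le>
    (\<Sum>k<N. bexp p {..<N} (ddiff k (exit_ind C i))) / (real N - 1)"
proof -
  let ?I = "\<lambda>k. bexp p {..<N} (ddiff k (exit_ind C i))"
  have ge0: "0 \<le> ?I k" for k
    using p by (intro bexp_nonneg ddiff_nonneg mono_exit_ind)
  have Ii: "?I i = 0"
  proof -
    have "ddiff i (exit_ind C i) = (\<lambda>_. 0)" by (auto simp: ddiff_def exit_ind_def)
    then show ?thesis by (simp add: bexp_const)
  qed
  show ?thesis
  proof (cases "j = i")
    case True
    then show ?thesis using Ii ge0 N by (simp add: sum_nonneg)
  next
    case False
    have "(\<Sum>k<N. ?I k) = (\<Sum>k\<in>{..<N} - {i}. ?I k)"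
      using i Ii by (simp add: sum.remove[of _ i])
    also have "\<dots> = (\<Sum>k\<in>{..<N} - {i}. ?I j)"
      using False by (intro sum.cong exit_influence_eq[OF C dt i _ j]) auto
    also have "\<dots> = (real N - 1) * ?I j"
      using i N by simp
    finally show ?thesis using N by simp
  qed
qed

section \<open>Area theorem and the rate bound\<close>

text \<open>The logarithm is the dimension of the subcode. Allowing position \<open>i\<close> either
  changes nothing or adds one coset, the translate \<open>T\<close> by a codeword nonzero at
  \<open>i\<close>, which doubles the cardinality.\<close>

lemma ddiff_log_card_subcode:
  assumes C: "binary_linear_code N C"
  shows "ddiff i (\<lambda>A. log 2 (card (subcode C A))) A = exit_ind C i A"
proof -
  let ?C1 = "subcode C (insert i A)" and ?C0 = "subcode C (A - {i})"
  have fin: "finite ?C0" using finite_code[OF C] by (simp add: subcode_def)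
  have zero: "(\<lambda>_. False) \<in> ?C0" using C by (simp add: subcode_def binary_linear_code_def)
  have add: "(\<lambda>j. x j \<noteq> y j) \<in> C" if "x \<in> C" "y \<in> C" for x y
    using C that by (simp add: binary_linear_code_def)
  show ?thesis
  proof (cases "\<exists>c\<in>?C1. c i")
    case True
    then obtain c where c: "c \<in> ?C1" "c i" by blast
    define T where "T x = (\<lambda>j. x j \<noteq> c j)" for x
    have TT: "T (T x) = x" for x by (auto simp: T_def)
    have "?C1 = ?C0 \<union> T ` ?C0"
    proof (intro equalityI subsetI)
      fix x assume x: "x \<in> ?C1"
      show "x \<in> ?C0 \<union> T ` ?C0"
      proof (cases "x i")
        case True
        then have "T x \<in> ?C0" using x c add by (auto simp: subcode_def T_def)
        then show ?thesis using TT[of x] by (metis UnI2 imageI)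
      qed (use x in \<open>auto simp: subcode_def\<close>)
    next
      fix x assume "x \<in> ?C0 \<union> T ` ?C0"
      then show "x \<in> ?C1" using c add by (auto simp: subcode_def T_def)
    qed
    moreover have "?C0 \<inter> T ` ?C0 = {}" using c by (auto simp: subcode_def T_def)
    moreover have "inj_on T ?C0" using TT by (metis inj_onI)
    ultimately have "card ?C1 = 2 * card ?C0"
      using fin by (simp add: card_Un_disjoint card_image)
    moreover have "0 < card ?C0" using fin zero by (auto simp: card_gt_0_iff)
    ultimately show ?thesis using True by (simp add: ddiff_def exit_ind_def log_mult)
  next
    case False
    then have "?C1 = ?C0" by (auto simp: subcode_def)
    then show ?thesis using False by (simp add: ddiff_def exit_ind_def)
  qed
qed

lemma bexp_exit_mono:
  assumes "0 \<le> p" "p \<le> q" "q \<le> 1"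
  shows "bexp p {..<N} (exit_ind C i) \<le> bexp q {..<N} (exit_ind C i)"
proof (rule DERIV_nonneg_imp_nondecreasing[OF assms(2)])
  fix x assume "p \<le> x" "x \<le> q"
  then have "0 \<le> (\<Sum>j<N. bexp x {..<N} (ddiff j (exit_ind C i)))"
    using assms by (intro sum_nonneg bexp_nonneg ddiff_nonneg mono_exit_ind) auto
  then show "\<exists>y. ((\<lambda>p. bexp p {..<N} (exit_ind C i)) has_real_derivative y) (at x) \<and> 0 \<le> y"
    using bexp_deriv[of "{..<N}"] by blast
qed

text \<open>A form of the area theorem: the expected dimension of the subcode supported on the erased
  positions has derivative \<open>\<Sum>i. h\<^sub>i\<close>, where \<open>h\<^sub>i\<close> is the \<open>i\<close>-th EXIT function.\<close>

lemma exit_le_rate: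
  assumes C: "binary_linear_code N C" and dt: "doubly_transitive N (perm_group N C)"
    and N: "3 \<le> N" and p: "0 \<le> p" "p < 1" and i: "i < N"
  shows "(1 - p) * bexp p {..<N} (exit_ind C i) \<le> code_rate N C"
proof -
  define G where "G p = bexp p {..<N} (\<lambda>A. log 2 (card (subcode C A)))" for p
  have "(\<Sum>j<N. bexp x {..<N} (exit_ind C j)) = (\<Sum>j<N. bexp x {..<N} (exit_ind C i))" for x
    using exit_eq[OF C dt N _ i] by (intro sum.cong) auto
  then have der: "(G has_real_derivative real N * bexp x {..<N} (exit_ind C i)) (at x)" for x
    using bexp_deriv[of "{..<N}" "\<lambda>A. log 2 (card (subcode C A))" x]
    by (simp add: G_def[abs_def] ext[OF ddiff_log_card_subcode[OF C]])
  \<comment> \<open>The mean value theorem replaces the integral over \<open>[p, 1]\<close>: by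
    monotonicity the slope at \<open>z\<close> is at least the one at \<open>p\<close>.\<close>
  obtain z where z: "p < z" "z < 1" "G 1 - G p = (1 - p) * (real N * bexp z {..<N} (exit_ind C i))"
    using MVT2[OF p(2) der] by blast
  have "subcode C {..<N} = C"
    using C by (auto simp: subcode_def binary_linear_code_def subset_eq not_le[symmetric])
  then have G1: "G 1 = log 2 (card C)" by (simp add: G_def bexp_at_1)
  have "0 \<le> G p"
    unfolding G_def
  proof (rule bexp_nonneg)
    fix A
    have "(\<lambda>_. False) \<in> subcode C A" "finite (subcode C A)"
      using C finite_code[OF C] by (auto simp: subcode_def binary_linear_code_def)
    then have "1 \<le> card (subcode C A)" by (metis One_nat_def Suc_leI card_gt_0_iff empty_iff)
    then show "0 \<le> log 2 (card (subcode C A))" by simp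
  qed (use p in auto)
  moreover have "(1 - p) * (real N * bexp p {..<N} (exit_ind C i))
      \<le> (1 - p) * (real N * bexp z {..<N} (exit_ind C i))"
    using z p by (intro mult_left_mono bexp_exit_mono) auto
  ultimately have "(1 - p) * (real N * bexp p {..<N} (exit_ind C i)) \<le> log 2 (card C)"
    using z(3) G1 by linarith
  then show ?thesis
    using N by (simp add: code_rate_def field_simps)
qed

section \<open>Bit-MAP error against the EXIT function\<close>

text \<open>If bit \<open>k\<close> is ambiguous, the difference of two compatible codewords
  witnesses \<open>exit_ind\<close>. The latter ignores whether bit \<open>k\<close> itself was
  received, so only an upper bound results, which suffices for a limit of zero.\<close>

lemma bit_map_Pb_bounds:
  assumes C: "binary_linear_code N C" and dt: "doubly_transitive N (perm_group N C)"
    and N: "3 \<le> N" and p: "0 \<le> p" "p \<le> 1" and i: "i < N"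
  shows "0 \<le> bit_map_Pb N C p" "bit_map_Pb N C p \<le> bexp p {..<N} (exit_ind C i)"
proof -
  define e where "e k E = (1 / real (card C)) * (\<Sum>x\<in>C.
    (if \<exists>c\<in>C. (\<forall>j<N. j \<notin> E \<longrightarrow> c j = x j) \<and> c k \<noteq> x k then 1 else 0 :: real))" for k E
  have Pb: "bit_map_Pb N C p = (1 / real N) * (\<Sum>k<N. bexp p {..<N} (e k))"
    by (simp add: bit_map_Pb_def bexp_def e_def)
  have e0: "0 \<le> e k E" for k E by (auto simp: e_def intro!: divide_nonneg_nonneg sum_nonneg)
  show "0 \<le> bit_map_Pb N C p"
    unfolding Pb using p e0 by (intro mult_nonneg_nonneg sum_nonneg bexp_nonneg) auto
  have cC: "0 < card C"
    using C finite_code[OF C] by (auto simp: card_gt_0_iff binary_linear_code_def)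
  have e_le: "e k E \<le> exit_ind C k E" for k E
  proof -
    have "(if \<exists>c\<in>C. (\<forall>j<N. j \<notin> E \<longrightarrow> c j = x j) \<and> c k \<noteq> x k then 1 else 0 :: real) \<le> exit_ind C k E"
      if x: "x \<in> C" for x
    proof (cases "\<exists>c\<in>C. (\<forall>j<N. j \<notin> E \<longrightarrow> c j = x j) \<and> c k \<noteq> x k")
      case True
      then obtain c where c: "c \<in> C" "\<And>j. j < N \<Longrightarrow> j \<notin> E \<Longrightarrow> c j = x j" "c k \<noteq> x k" by blast
      \<comment> \<open>Words are functions on all naturals, so agreement must also be checked
        beyond the block.\<close>
      have "\<not> c j \<and> \<not> x j" if "\<not> j < N" for j
        using C c(1) x that by (auto simp: binary_linear_code_def)
      then have "(\<lambda>j. c j \<noteq> x j) \<in> subcode C (insert k E)"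
        using C c x by (auto simp: subcode_def binary_linear_code_def)
      then have "exit_ind C k E = 1" using c(3) unfolding exit_ind_def by (simp add: bexI[where x = "\<lambda>j. c j \<noteq> x j"])
      then show ?thesis by simp
    next
      case False
      then show ?thesis unfolding if_not_P[OF False] by (simp add: exit_ind_def)
    qed
    then have "e k E \<le> (1 / real (card C)) * (\<Sum>x\<in>C. exit_ind C k E)"
      unfolding e_def by (intro mult_left_mono sum_mono) auto
    then show ?thesis using cC by simp
  qed
  have "bit_map_Pb N C p \<le> (1 / real N) * (\<Sum>k<N. bexp p {..<N} (exit_ind C k))"
    unfolding Pb using p e_le by (intro mult_left_mono sum_mono bexp_mono) auto
  also have "\<dots> = (1 / real N) * (\<Sum>k<N. bexp p {..<N} (exit_ind C i))"
    using exit_eq[OF C dt N _ i] by (intro arg_cong2[where f = "(*)"] sum.cong) auto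
  also have "\<dots> = bexp p {..<N} (exit_ind C i)" using N by simp
  finally show "bit_map_Pb N C p \<le> bexp p {..<N} (exit_ind C i)" .
qed

section \<open>Sharp threshold and passage to the limit\<close>

text \<open>Otherwise \<open>h * (1 - h)\<close> would be at least
  \<open>\<epsilon> * \<delta>\<close> on the whole interval, and the slope would make
  \<open>h\<close> rise by 2. The bound \<open>N0\<close> is uniform in the code, the position and
  \<open>p\<close>.\<close>

lemma exit_sharp_threshold:
  assumes \<epsilon>: "0 < \<epsilon>" and \<eta>: "0 < \<eta>" and \<delta>: "0 < \<delta>"
  shows "\<exists>N0. \<forall>N C i p. N0 \<le> N \<longrightarrow> binary_linear_code N C \<longrightarrow>
    doubly_transitive N (perm_group N C) \<longrightarrow> i < N \<longrightarrow> 0 \<le> p \<longrightarrow> p + \<eta> \<le> 1 \<longrightarrow>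
    \<epsilon> \<le> bexp p {..<N} (exit_ind C i) \<longrightarrow> 1 - \<delta> \<le> bexp (p + \<eta>) {..<N} (exit_ind C i)"
proof -
  \<comment> \<open>A slope of at least \<open>M\<close> over length \<open>\<eta>\<close> gives the
    rise 2. The choice of \<open>l\<close> makes \<open>l * \<epsilon> * \<delta>\<close> exceed
    \<open>2 * M\<close> by 1, and \<open>N0\<close> pushes the exponential term below that
    1.\<close>
  define M where "M = 2 / \<eta>"
  define l where "l = (2 * M + 1) / (\<epsilon> * \<delta>)"
  obtain N0 where N0: "exp l * M * M + 3 < real N0" using reals_Archimedean2 by blast
  have M0: "0 < M" using \<eta> by (simp add: M_def)
  have l0: "0 < l" using \<epsilon> \<delta> M0 by (simp add: l_def)
  have "1 - \<delta> \<le> bexp (p + \<eta>) {..<N} (exit_ind C i)"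
    if N: "N0 \<le> N" and C: "binary_linear_code N C" and dt: "doubly_transitive N (perm_group N C)"
      and i: "i < N" and p: "0 \<le> p" "p + \<eta> \<le> 1" and big: "\<epsilon> \<le> bexp p {..<N} (exit_ind C i)"
    for N C i p
  proof (rule ccontr)
    assume neg: "\<not> ?thesis"
    define h where "h x = bexp x {..<N} (exit_ind C i)" for x
    define h' where "h' x = (\<Sum>j<N. bexp x {..<N} (ddiff j (exit_ind C i)))" for x
    have der: "(h has_real_derivative h' x) (at x)" for x
      unfolding h_def[abs_def] h'_def by (rule bexp_deriv) simp
    have M_le: "M \<le> h' x" if x: "p < x" "x < p + \<eta>" for x
    proof (rule ccontr)
      assume "\<not> ?thesis"
      then have h'M: "h' x < M" by simp
      have h'0: "0 \<le> h' x"
        unfolding h'_def using x p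
        by (intro sum_nonneg bexp_nonneg ddiff_nonneg mono_exit_ind) auto
      have N3: "exp l * M * M + 2 < real N - 1" using N0 N by linarith
      have "0 < exp l * M * M" using M0 by simp
      with N3 have N2: "2 \<le> N" and N1: "0 < real N - 1" by linarith+
      have hx: "\<epsilon> \<le> h x" "\<delta> \<le> 1 - h x"
        using bexp_exit_mono[of p x N C i] bexp_exit_mono[of x "p + \<eta>" N C i] x p big neg
        by (auto simp: h_def)
      have "2 * M + 1 = l * (\<epsilon> * \<delta>)" using \<epsilon> \<delta> by (simp add: l_def)
      also have "\<dots> \<le> l * (h x * (1 - h x))"
        using hx \<epsilon> \<delta> l0 by (intro mult_left_mono mult_mono) auto
      also have "\<dots> \<le> (2 + exp l * (h' x / (real N - 1))) * h' x"
        unfolding h_def h'_def using x p i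
        by (intro monotone_boolean_influence_bound exit_ind_01 mono_exit_ind
            exit_influence_le[OF C dt N2]) auto
      also have "\<dots> \<le> (2 + exp l * (M / (real N - 1))) * M"
        using h'M h'0 N1 by (intro mult_mono add_mono mult_left_mono divide_right_mono) auto
      also have "\<dots> = 2 * M + exp l * M * M / (real N - 1)" by (simp add: algebra_simps)
      also have "\<dots> < 2 * M + 1" using N3 N1 by simp
      finally show False by simp
    qed
    obtain z where z: "p < z" "z < p + \<eta>" "h (p + \<eta>) - h p = (p + \<eta> - p) * h' z"
      using MVT2[of p "p + \<eta>" h h'] der \<eta> by auto
    have "\<eta> * M \<le> \<eta> * h' z" using M_le[OF z(1,2)] \<eta> by simp
    then have "2 \<le> h (p + \<eta>) - h p" using z(3) \<eta> by (simp add: M_def)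
    then show False using neg big \<epsilon> \<delta> by (simp add: h_def)
  qed
  then show ?thesis by blast
qed

theorem theorem3:
  fixes C :: "nat \<Rightarrow> (nat \<Rightarrow> bool) set" and N :: "nat \<Rightarrow> nat" and r :: real
  assumes codes: "\<And>n. binary_linear_code (N n) (C n)"
      and proper: "\<And>n. proper_code (N n) (C n)"
      and dist: "\<And>n. min_dist_ge2 (N n) (C n)"
      and len: "filterlim N at_top sequentially"
      and rate: "(\<lambda>n. code_rate (N n) (C n)) \<longlonglongrightarrow> r"
      and r01: "0 < r" "r < 1"
      and dt: "\<And>n. doubly_transitive (N n) (perm_group (N n) (C n))"
  shows "\<forall>p. 0 \<le> p \<and> p < 1 - r \<longrightarrow> (\<lambda>n. bit_map_Pb (N n) (C n) p) \<longlonglongrightarrow> 0"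
proof (intro allI impI)
  fix p assume p: "0 \<le> p \<and> p < 1 - r"
  \<comment> \<open>Position 0 represents all positions, by symmetry once
    \<open>3 \<le> N n\<close>; \<open>small\<close> therefore carries that bound along.\<close>
  define h where "h n x = bexp x {..<N n} (exit_ind (C n) 0)" for n x
  \<comment> \<open>A third of the gap to capacity, so \<open>1 - (p + \<eta>)\<close> is
    \<open>r + 2 * \<eta>\<close>. One \<open>\<eta>\<close> absorbs the error of the rate, the
    other the loss from the factor \<open>1 - \<eta>\<close>, as
    \<open>r + 2 * \<eta> \<le> 1\<close>.\<close>
  define \<eta> where "\<eta> = (1 - r - p) / 3"
  have \<eta>: "0 < \<eta>" "p + \<eta> < 1" using p r01 by (auto simp: \<eta>_def field_simps)
  have N_ge: "\<forall>\<^sub>F n in sequentially. m \<le> N n" for m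
    using len by (simp add: filterlim_at_top)
  have rate_lt: "\<forall>\<^sub>F n in sequentially. code_rate (N n) (C n) < r + \<eta>"
    using order_tendstoD(2)[OF rate] \<eta> by simp
  have small: "\<forall>\<^sub>F n in sequentially. 3 \<le> N n \<and> h n p < \<epsilon>" if "0 < \<epsilon>" for \<epsilon>
  proof -
    obtain N0 where N0: "\<And>N C i p. N0 \<le> N \<Longrightarrow> binary_linear_code N C \<Longrightarrow>
        doubly_transitive N (perm_group N C) \<Longrightarrow> i < N \<Longrightarrow> 0 \<le> p \<Longrightarrow> p + \<eta> \<le> 1 \<Longrightarrow>
        \<epsilon> \<le> bexp p {..<N} (exit_ind C i) \<Longrightarrow> 1 - \<eta> \<le> bexp (p + \<eta>) {..<N} (exit_ind C i)"
      using exit_sharp_threshold[OF \<open>0 < \<epsilon>\<close> \<eta>(1) \<eta>(1)] by blast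
    show ?thesis
      using N_ge[of "max 3 N0"] rate_lt
    proof eventually_elim
      case (elim n)
      then have n3: "3 \<le> N n" by simp
      have "h n p < \<epsilon>"
      proof (rule ccontr)
        assume "\<not> ?thesis"
        then have "\<epsilon> \<le> h n p" by simp
        then have big: "1 - \<eta> \<le> h n (p + \<eta>)"
          unfolding h_def using elim p \<eta> n3 by (intro N0[OF _ codes dt]) auto
        have "(r + 2 * \<eta>) * (1 - \<eta>) = (1 - (p + \<eta>)) * (1 - \<eta>)" by (simp add: \<eta>_def field_simps)
        also have "\<dots> \<le> (1 - (p + \<eta>)) * h n (p + \<eta>)"
          using big \<eta> by (intro mult_left_mono) auto
        also have "\<dots> \<le> code_rate (N n) (C n)"
          unfolding h_def using p \<eta> n3 by (intro exit_le_rate codes dt) auto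
        finally have "(r + 2 * \<eta>) * (1 - \<eta>) < r + \<eta>" using elim by simp
        moreover have "(r + 2 * \<eta>) * \<eta> \<le> \<eta>"
          using p \<eta> r01 by (intro mult_left_le_one_le) (auto simp: \<eta>_def field_simps)
        ultimately show False by (simp add: algebra_simps)
      qed
      with n3 show ?case by simp
    qed
  qed
  show "(\<lambda>n. bit_map_Pb (N n) (C n) p) \<longlonglongrightarrow> 0"
  proof (rule tendstoI)
    fix \<epsilon> :: real assume "0 < \<epsilon>"
    from small[OF this]
    show "\<forall>\<^sub>F n in sequentially. dist (bit_map_Pb (N n) (C n) p) 0 < \<epsilon>"
    proof eventually_elim
      case (elim n)
      then show ?case
        using bit_map_Pb_bounds[OF codes dt, of n p 0] p r01 by (simp add: h_def dist_real_def)
    qed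
  qed
qed

end
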